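(* Let $X$ be a Hausdorff space and let $\mathbf{F}$ be a $1$-independent normed space of continuous functions over $X$ that satisfies one of the following conditions: (i) $\mathbf{F}$ is compactly embedded; (ii) $\mathbf{F}$ is weakly compactly embedded and nearly strictly convex, and the closed unit ball $\overline{B}_{\mathbf{F}}$ is closed in $\mathcal{C}(X)$; (iii) $\mathbf{F}$ is weakly compactly embedded and $\mathbf{F}^{**}$ is nearly strictly convex; (iv) $\mathbf{F}$ is reflexive and nearly strictly convex. Let $\mathbf{E}$ be a normed space of continuous functions over a Hausdorff space $Y$. If $\Phi:Y\to X$ is such that $\Phi(Y)$ is connected, and $\omega,\upsilon:Y\to\mathbb{C}\setminus\{0\}$ are such that there is a unitary $S:\mathbf{F}\to\mathbf{F}$ with $W_{\Phi,\omega}=W_{\Phi,\upsilon}S$ on $\mathbf{F}$ (for example, if both $W_{\Phi,\omega}$ and $W_{\Phi,\upsilon}$ are unitaries from $\mathbf{F}$ onto $\mathbf{E}$), then there is $\lambda\in\mathbb{C}$ with $|\lambda|=1$ such that $\upsilon=\lambda\omega$.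
   Context: All spaces are over $\mathbb{C}$. $\mathcal{C}(X)$ is the space of all continuous functions $X\to\mathbb{C}$ with the compact-open topology. A normed space of continuous functions (NSCF) over $X$ is a linear subspace $\mathbf{F}\subset\mathcal{C}(X)$ equipped with a norm (not necessarily complete) such that the inclusion $\mathbf{F}\to\mathcal{C}(X)$ is continuous. $B_{\mathbf{F}}$ and $\overline{B}_{\mathbf{F}}$ are the open and closed unit balls of $\mathbf{F}$, and $\mathbf{F}^{**}$ is the bidual of $\mathbf{F}$. $\mathbf{F}$ is (weakly) compactly embedded if $B_{\mathbf{F}}$ is (weakly) relatively compact in $\mathcal{C}(X)$. $\mathbf{F}$ is $1$-independent if for every $x\in X$ there is $f\in\mathbf{F}$ with $f(x)\neq 0$. For maps $\Phi:Y\to X$ and $\omega:Y\to\mathbb{C}$ (not assumed continuous), the weighted composition operator $W_{\Phi,\omega}$ is given by $[W_{\Phi,\omega}f](y)=\omega(y)f(\Phi(y))$, $y\in Y$. A unitary is a surjective linear isometry between normed spaces. A normed space $F$ is nearly strictly convex if every convex subset of its unit sphere is precompact (totally bounded) in $F$. *)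

theory Defs
  imports "HOL-Analysis.Analysis" "HOL-Library.Function_Algebras"
begin

section \<open>Pointwise vector space structure on functions\<close>

text \<open>The real structure makes the library constant \<^const>\<open>convex\<close> available for sets of functions;
  the complex structure is given by \<open>cscale\<close>.\<close>

instantiation "fun" :: (type, real_vector) real_vector
begin

definition scaleR_fun :: "real \<Rightarrow> ('a \<Rightarrow> 'b) \<Rightarrow> 'a \<Rightarrow> 'b"
  where "scaleR_fun r f = (\<lambda>x. r *\<^sub>R f x)"

instance
  by standard (auto simp: scaleR_fun_def fun_eq_iff scaleR_add_right scaleR_add_left)

end

definition cscale :: "complex \<Rightarrow> ('a \<Rightarrow> complex) \<Rightarrow> 'a \<Rightarrow> complex"
  where "cscale c f = (\<lambda>x. c * f x)"

interpretation cfun: vector_space cscale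
  by unfold_locales (auto simp: cscale_def fun_eq_iff algebra_simps)

text \<open>Complex linearity on a linear subspace; \<open>s\<close> is the scalar multiplication of the codomain.\<close>

definition clinear_on ::
    "('a \<Rightarrow> complex) set \<Rightarrow> (complex \<Rightarrow> 'b \<Rightarrow> 'b) \<Rightarrow> (('a \<Rightarrow> complex) \<Rightarrow> 'b::ab_group_add) \<Rightarrow> bool"
  where "clinear_on V s T \<longleftrightarrow>
    (\<forall>f\<in>V. \<forall>g\<in>V. T (f + g) = T f + T g) \<and> (\<forall>c. \<forall>f\<in>V. T (cscale c f) = s c (T f))"

section \<open>Normed spaces of complex-valued functions on a set\<close>

text \<open>Functions, functionals on functions, and functionals on functionals all have types of the form
  \<open>'a \<Rightarrow> complex\<close>, so a space, its dual and its bidual are all instances of the following record.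
  The norm is only meaningful on the carrier.\<close>

record 'a fun_space =
  carr :: "('a \<Rightarrow> complex) set"
  nrm :: "('a \<Rightarrow> complex) \<Rightarrow> real"

definition normed_fun_space :: "'a fun_space \<Rightarrow> bool"
  where "normed_fun_space F \<longleftrightarrow>
    cfun.subspace (carr F) \<and>
    (\<forall>f\<in>carr F. 0 \<le> nrm F f) \<and>
    (\<forall>f\<in>carr F. nrm F f = 0 \<longleftrightarrow> f = 0) \<and>
    (\<forall>f\<in>carr F. \<forall>g\<in>carr F. nrm F (f + g) \<le> nrm F f + nrm F g) \<and>
    (\<forall>c. \<forall>f\<in>carr F. nrm F (cscale c f) = cmod c * nrm F f)"

definition open_unit_ball :: "'a fun_space \<Rightarrow> ('a \<Rightarrow> complex) set"
  where "open_unit_ball F = {f \<in> carr F. nrm F f < 1}"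

definition closed_unit_ball :: "'a fun_space \<Rightarrow> ('a \<Rightarrow> complex) set"
  where "closed_unit_ball F = {f \<in> carr F. nrm F f \<le> 1}"

definition unit_sphere :: "'a fun_space \<Rightarrow> ('a \<Rightarrow> complex) set"
  where "unit_sphere F = {f \<in> carr F. nrm F f = 1}"

text \<open>The distance is set to 0 off the carrier because the locale \<^locale>\<open>Metric_space\<close> requires
  nonnegativity and symmetry on the whole type.\<close>

definition norm_dist :: "'a fun_space \<Rightarrow> ('a \<Rightarrow> complex) \<Rightarrow> ('a \<Rightarrow> complex) \<Rightarrow> real"
  where "norm_dist F f g = (if f \<in> carr F \<and> g \<in> carr F then nrm F (f - g) else 0)"

lemma Metric_space_norm_dist:
  assumes "normed_fun_space F"
  shows "Metric_space (carr F) (norm_dist F)"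
proof
  have sub: "cfun.subspace (carr F)" using assms by (simp add: normed_fun_space_def)
  note diff = cfun.subspace_diff[OF sub]
  show "0 \<le> norm_dist F f g" for f g
    using assms diff by (auto simp: norm_dist_def normed_fun_space_def)
  show "norm_dist F f g = norm_dist F g f" for f g
  proof -
    have "nrm F (f - g) = nrm F (g - f)" if fg: "f \<in> carr F" "g \<in> carr F"
    proof -
      have eq: "f - g = cscale (-1) (g - f)" by (auto simp: cscale_def fun_eq_iff)
      have "nrm F (cscale (-1) (g - f)) = cmod (-1) * nrm F (g - f)"
        using assms diff[OF fg(2,1)] unfolding normed_fun_space_def by blast
      then show ?thesis by (subst eq) simp
    qed
    then show ?thesis by (simp add: norm_dist_def)
  qed
  show "norm_dist F f g = 0 \<longleftrightarrow> f = g" if "f \<in> carr F" "g \<in> carr F" for f g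
    using that assms diff by (auto simp: norm_dist_def normed_fun_space_def)
  show "norm_dist F f h \<le> norm_dist F f g + norm_dist F g h"
    if "f \<in> carr F" "g \<in> carr F" "h \<in> carr F" for f g h
  proof -
    have "nrm F ((f - g) + (g - h)) \<le> nrm F (f - g) + nrm F (g - h)"
      using assms diff[OF that(1,2)] diff[OF that(2,3)] unfolding normed_fun_space_def by blast
    then show ?thesis using that by (simp add: norm_dist_def)
  qed
qed

definition norm_topology :: "'a fun_space \<Rightarrow> ('a \<Rightarrow> complex) topology"
  where "norm_topology F = Metric_space.mtopology (carr F) (norm_dist F)"

definition nearly_strictly_convex :: "'a fun_space \<Rightarrow> bool"
  where "nearly_strictly_convex F \<longleftrightarrow>
    (\<forall>C. C \<subseteq> unit_sphere F \<and> convex C \<longrightarrow>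
      Metric_space.mtotally_bounded (carr F) (norm_dist F) C)"

text \<open>The dual consists of the bounded linear functionals on the carrier, extended by 0 to the whole
  type; the extension makes functionals that agree on the carrier equal.\<close>

definition dual_space :: "'a fun_space \<Rightarrow> ('a \<Rightarrow> complex) fun_space"
  where "dual_space F =
    \<lparr>carr = {\<phi>. clinear_on (carr F) (*) \<phi> \<and> (\<forall>f. f \<notin> carr F \<longrightarrow> \<phi> f = 0) \<and>
                (\<exists>B. \<forall>f\<in>carr F. cmod (\<phi> f) \<le> B * nrm F f)},
     nrm = (\<lambda>\<phi>. SUP f\<in>closed_unit_ball F. cmod (\<phi> f))\<rparr>"

abbreviation bidual_space :: "'a fun_space \<Rightarrow> (('a \<Rightarrow> complex) \<Rightarrow> complex) fun_space"
  where "bidual_space F \<equiv> dual_space (dual_space F)"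

definition canonical_embedding ::
    "'a fun_space \<Rightarrow> ('a \<Rightarrow> complex) \<Rightarrow> (('a \<Rightarrow> complex) \<Rightarrow> complex) \<Rightarrow> complex"
  where "canonical_embedding F f = (\<lambda>\<phi>. if \<phi> \<in> carr (dual_space F) then \<phi> f else 0)"

definition reflexive :: "'a fun_space \<Rightarrow> bool"
  where "reflexive F \<longleftrightarrow> canonical_embedding F ` carr F = carr (bidual_space F)"

definition unitary_map ::
    "'a fun_space \<Rightarrow> 'b fun_space \<Rightarrow> (('a \<Rightarrow> complex) \<Rightarrow> 'b \<Rightarrow> complex) \<Rightarrow> bool"
  where "unitary_map F E T \<longleftrightarrow>
    clinear_on (carr F) cscale T \<and> T ` carr F = carr E \<and> (\<forall>f\<in>carr F. nrm E (T f) = nrm F f)"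

section \<open>The space of continuous functions\<close>

text \<open>The carrier of both topologies below is the set of all continuous functions.\<close>

definition compact_open_topology :: "('x::topological_space \<Rightarrow> complex) topology"
  where "compact_open_topology =
    topology_generated_by
      {{f. continuous_on UNIV f \<and> f ` K \<subseteq> U} | K U. compact K \<and> open U}"

lemma topspace_compact_open:
  "topspace compact_open_topology = {f :: 'x::topological_space \<Rightarrow> complex. continuous_on UNIV f}"
proof
  show "topspace compact_open_topology \<subseteq> {f :: 'x \<Rightarrow> complex. continuous_on UNIV f}"
    by (auto simp only: compact_open_topology_def topology_generated_by_topspace Union_iff mem_Collect_eq)
next
  have "openin compact_open_topology {f :: 'x \<Rightarrow> complex. continuous_on UNIV f \<and> f ` {} \<subseteq> UNIV}"
    unfolding compact_open_topology_def
    by (rule topology_generated_by_Basis, rule CollectI, rule exI[of _ "{}"], rule exI[of _ UNIV]) simp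
  then show "{f :: 'x \<Rightarrow> complex. continuous_on UNIV f} \<subseteq> topspace compact_open_topology"
    using openin_subset by fastforce
qed

definition weak_topology :: "('x::topological_space \<Rightarrow> complex) topology"
  where "weak_topology =
    topology_generated_by
      {{f. continuous_on UNIV f \<and> \<phi> f \<in> U} | \<phi> U.
        clinear_on {f. continuous_on UNIV f} (*) \<phi> \<and>
        continuous_map compact_open_topology euclidean \<phi> \<and> open U}"

definition nscf :: "'x::topological_space fun_space \<Rightarrow> bool"
  where "nscf F \<longleftrightarrow>
    normed_fun_space F \<and> continuous_map (norm_topology F) compact_open_topology (\<lambda>f. f)"

definition relatively_compact_in :: "'a topology \<Rightarrow> 'a set \<Rightarrow> bool"
  where "relatively_compact_in T A \<longleftrightarrow> A \<subseteq> topspace T \<and> compactin T (T closure_of A)"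

definition compactly_embedded :: "'x::topological_space fun_space \<Rightarrow> bool"
  where "compactly_embedded F \<longleftrightarrow> relatively_compact_in compact_open_topology (open_unit_ball F)"

definition weakly_compactly_embedded :: "'x::topological_space fun_space \<Rightarrow> bool"
  where "weakly_compactly_embedded F \<longleftrightarrow> relatively_compact_in weak_topology (open_unit_ball F)"

definition one_independent :: "'x fun_space \<Rightarrow> bool"
  where "one_independent F \<longleftrightarrow> (\<forall>x. \<exists>f\<in>carr F. f x \<noteq> 0)"

definition weighted_comp :: "('y \<Rightarrow> 'x) \<Rightarrow> ('y \<Rightarrow> complex) \<Rightarrow> ('x \<Rightarrow> complex) \<Rightarrow> 'y \<Rightarrow> complex"
  where "weighted_comp \<Phi> \<omega> f = (\<lambda>y. \<omega> y * f (\<Phi> y))"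

end

theory Submission
  imports Defs
begin

text \<open>
  Cancelling the nonvanishing weights in \<open>W\<^sub>\<omega> = W\<^sub>\<upsilon> S\<close> shows that \<open>S\<close> acts on
  \<open>Z = \<Phi>(Y)\<close> as multiplication by \<open>m\<close>, where \<open>m(\<Phi> y) = \<omega> y / \<upsilon> y\<close>; \<open>1\<close>-independence makes \<open>m\<close>
  well defined. So \<open>\<omega>/\<upsilon>\<close> has to be shown to be a unimodular constant, that is, \<open>m\<close> has to be
  unimodular and locally constant on the connected set \<open>Z\<close>.

  Each of the four conditions on \<open>F\<close> places its unit ball inside a set \<open>K\<close> of continuous functions
  that is compact for pointwise convergence. Under (i), (ii) and (iii) this is the closure of the
  ball in the compact-open or the weak topology, since point evaluations are continuous there. For
  reflexive \<open>F\<close> it is the image of the unit ball of the bidual, which is compact by the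
  Banach--Alaoglu theorem.

  Unimodularity (\<open>eigenvalue_unimodular\<close>): \<open>S\<close> permutes the unit ball, so the supremum of
  \<open>\<bar>f z\<bar>\<close> over the ball, finite by compactness and nonzero, is unchanged when multiplied by \<open>\<bar>m z\<bar>\<close>.

  Local constancy (\<open>eigenspace_cutoff_continuous\<close>, \<open>multiplier_constant\<close>): for \<open>\<bar>\<mu>\<bar> = 1\<close> the
  contraction \<open>T = (1 + S/\<mu>)/2\<close> acts on \<open>Z\<close> as multiplication by \<open>(1 + m/\<mu>)/2\<close>. This factor is \<open>1\<close>
  where \<open>m = \<mu>\<close> and has modulus less than \<open>1\<close> elsewhere, so for \<open>f\<close> in the unit ball the iterates
  \<open>T\<^sup>n f\<close> converge pointwise on \<open>Z\<close> to \<open>f\<close> cut off to \<open>{m = \<mu>}\<close>. They stay in \<open>K\<close>, and a cluster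
  point there is a continuous function that agrees on \<open>Z\<close> with the cut-off of \<open>f\<close>. If
  \<open>\<mu> = m a\<close> and \<open>f a \<noteq> 0\<close>, this function is nonzero at \<open>a\<close>, hence near \<open>a\<close>, and therefore \<open>m = \<mu>\<close>
  near \<open>a\<close>.
\<close>

section \<open>Pointwise compactness of the unit ball\<close>

text \<open>Here \<^const>\<open>compact\<close> refers to the product topology on functions, that is, to pointwise
  convergence. Pointwise limits of continuous functions may be discontinuous, so the continuity of
  the elements of \<open>K\<close> is the substance of the condition.\<close>

definition pointwise_compactly_embedded :: "'x::topological_space fun_space \<Rightarrow> bool"
  where "pointwise_compactly_embedded F \<longleftrightarrow>
    (\<exists>K. compact K \<and> open_unit_ball F \<subseteq> K \<and> (\<forall>g\<in>K. continuous_on UNIV g))"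

lemma continuous_map_compact_open_eval:
  fixes x :: "'x::topological_space"
  shows "continuous_map compact_open_topology euclidean (\<lambda>f::'x \<Rightarrow> complex. f x)"
proof -
  have "openin compact_open_topology
          {f \<in> topspace compact_open_topology. (f::'x \<Rightarrow> complex) x \<in> U}" if "open U" for U
  proof -
    have "openin compact_open_topology {f::'x \<Rightarrow> complex. continuous_on UNIV f \<and> f ` {x} \<subseteq> U}"
      unfolding compact_open_topology_def
      by (rule topology_generated_by_Basis, rule CollectI, rule exI[of _ "{x}"], rule exI[of _ U])
        (use that in simp)
    then show ?thesis by (simp add: topspace_compact_open)
  qed
  then show ?thesis by (auto simp: continuous_map_def)
qed

lemma topspace_weak_subset:
  "topspace (weak_topology :: ('x::topological_space \<Rightarrow> complex) topology)
    \<subseteq> {f. continuous_on UNIV f}"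
  by (auto simp only: weak_topology_def topology_generated_by_topspace Union_iff mem_Collect_eq)

lemma continuous_map_weak_eval:
  fixes x :: "'x::topological_space"
  shows "continuous_map weak_topology euclidean (\<lambda>f::'x \<Rightarrow> complex. f x)"
proof -
  have "openin weak_topology
          {f \<in> topspace weak_topology. (f::'x \<Rightarrow> complex) x \<in> U}" if "open U" for U
  proof -
    have lin: "clinear_on {f. continuous_on UNIV f} (*) (\<lambda>f::'x \<Rightarrow> complex. f x)"
      by (simp add: clinear_on_def cscale_def)
    have "openin weak_topology {f::'x \<Rightarrow> complex. continuous_on UNIV f \<and> f x \<in> U}"
      unfolding weak_topology_def
      by (rule topology_generated_by_Basis, rule CollectI, rule exI[of _ "\<lambda>f. f x"], rule exI[of _ U])
        (use that lin continuous_map_compact_open_eval[of x] in simp)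
    moreover from this have "{f::'x \<Rightarrow> complex. continuous_on UNIV f \<and> f x \<in> U} \<subseteq> topspace weak_topology"
      by (rule openin_subset)
    then have "{f \<in> topspace weak_topology. (f::'x \<Rightarrow> complex) x \<in> U}
        = {f. continuous_on UNIV f \<and> f x \<in> U}"
      using topspace_weak_subset by auto
    ultimately show ?thesis by simp
  qed
  then show ?thesis by (auto simp: continuous_map_def)
qed

text \<open>Continuity of the evaluations says that the identity from \<open>T\<close> to the topology of pointwise
  convergence is continuous, so it carries a \<open>T\<close>-compact set to a pointwise compact one.\<close>

lemma pointwise_compactly_embedded_if_relatively_compact:
  fixes F :: "'x::topological_space fun_space"
  assumes rc: "relatively_compact_in T (open_unit_ball F)"
    and cont: "topspace T \<subseteq> {f. continuous_on UNIV f}"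
    and eval: "\<And>x. continuous_map T euclidean (\<lambda>f. f x)"
  shows "pointwise_compactly_embedded F"
proof -
  let ?K = "T closure_of open_unit_ball F"
  have "continuous_map T euclidean (\<lambda>f. f)"
    by (simp add: euclidean_product_topology[symmetric] continuous_map_componentwise_UNIV eval)
  then have "compactin euclidean ((\<lambda>f. f) ` ?K)"
    using rc image_compactin unfolding relatively_compact_in_def by blast
  then have "compact ?K" by simp
  moreover have "open_unit_ball F \<subseteq> ?K"
    using rc by (simp add: relatively_compact_in_def closure_of_subset)
  moreover have "\<forall>g\<in>?K. continuous_on UNIV g"
    using cont closure_of_subset_topspace by fast
  ultimately show ?thesis unfolding pointwise_compactly_embedded_def by blast
qed

text \<open>Banach--Alaoglu: the dual ball is cut out of a product of closed discs, compact by Tychonoff's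
  theorem, by the linearity equations, and each of these is closed for pointwise convergence. Off
  the carrier the discs have radius \<open>0\<close>, which encodes the extension by \<open>0\<close>.\<close>

lemma compact_dual_ball:
  "compact {\<psi> \<in> carr (dual_space G). \<forall>f\<in>carr G. cmod (\<psi> f) \<le> nrm G f}"
proof -
  let ?B = "PiE UNIV (\<lambda>f. cball 0 (if f \<in> carr G then nrm G f else 0)) :: (('a \<Rightarrow> complex) \<Rightarrow> complex) set"
  let ?A = "\<Inter>f\<in>carr G. \<Inter>g\<in>carr G. {\<psi>::('a \<Rightarrow> complex) \<Rightarrow> complex. \<psi> (f + g) = \<psi> f + \<psi> g}"
  let ?M = "\<Inter>c. \<Inter>f\<in>carr G. {\<psi>::('a \<Rightarrow> complex) \<Rightarrow> complex. \<psi> (cscale c f) = c * \<psi> f}"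
  have "compactin (product_topology (\<lambda>_. euclidean) UNIV) ?B"
    by (simp add: compactin_PiE)
  then have "compact ?B" by (simp add: euclidean_product_topology)
  moreover have coord: "continuous_on UNIV (\<lambda>\<psi>::('a \<Rightarrow> complex) \<Rightarrow> complex. \<psi> f)" for f
    by (rule continuous_on_product_coordinates)
  have "closed ?A"
    by (intro closed_INT ballI closed_Collect_eq continuous_intros coord)
  moreover have "closed ?M"
    by (intro closed_INT ballI closed_Collect_eq continuous_intros coord)
  ultimately have "compact (?B \<inter> ?A \<inter> ?M)"
    by (intro compact_Int_closed)
  moreover have "{\<psi> \<in> carr (dual_space G). \<forall>f\<in>carr G. cmod (\<psi> f) \<le> nrm G f} = ?B \<inter> ?A \<inter> ?M"
  proof (intro set_eqI iffI)
    fix \<psi> assume "\<psi> \<in> {\<psi> \<in> carr (dual_space G). \<forall>f\<in>carr G. cmod (\<psi> f) \<le> nrm G f}"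
    then show "\<psi> \<in> ?B \<inter> ?A \<inter> ?M"
      by (auto simp: dual_space_def clinear_on_def PiE_iff)
  next
    fix \<psi> assume \<psi>: "\<psi> \<in> ?B \<inter> ?A \<inter> ?M"
    then have b: "cmod (\<psi> f) \<le> (if f \<in> carr G then nrm G f else 0)" for f
      by (auto simp: PiE_iff)
    have ball: "\<forall>f\<in>carr G. cmod (\<psi> f) \<le> nrm G f"
    proof
      show "cmod (\<psi> f) \<le> nrm G f" if "f \<in> carr G" for f
        using b[of f] that by simp
    qed
    then have "\<exists>B. \<forall>f\<in>carr G. cmod (\<psi> f) \<le> B * nrm G f"
      by (intro exI[of _ 1]) simp
    moreover have "\<psi> f = 0" if "f \<notin> carr G" for f
      using b[of f] that by simp
    ultimately show "\<psi> \<in> {\<psi> \<in> carr (dual_space G). \<forall>f\<in>carr G. cmod (\<psi> f) \<le> nrm G f}"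
      using \<psi> ball unfolding dual_space_def clinear_on_def by simp
  qed
  ultimately show ?thesis by simp
qed

lemma nscf_continuous:
  assumes "nscf F" "f \<in> carr F"
  shows "continuous_on UNIV f"
proof -
  interpret Metric_space "carr F" "norm_dist F"
    using assms by (intro Metric_space_norm_dist) (simp add: nscf_def)
  have "f \<in> topspace compact_open_topology"
    using assms continuous_map_image_subset_topspace
    unfolding nscf_def norm_topology_def by fastforce
  then show ?thesis by (simp add: topspace_compact_open)
qed

text \<open>Evaluation at \<open>x\<close> is continuous in the norm of \<open>F\<close>, so it is bounded by \<open>1\<close> on some ball around
  \<open>0\<close>; by homogeneity it is a bounded functional.\<close>

lemma nscf_eval_bounded:
  assumes "nscf F"
  shows "\<exists>B. \<forall>f\<in>carr F. cmod (f x) \<le> B * nrm F f"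
proof -
  have nf: "normed_fun_space F" using assms by (simp add: nscf_def)
  interpret Metric_space "carr F" "norm_dist F"
    using nf by (rule Metric_space_norm_dist)
  have sub: "cfun.subspace (carr F)" using nf by (simp add: normed_fun_space_def)
  have "continuous_map mtopology euclidean ((\<lambda>f. f x) \<circ> (\<lambda>f. f))"
    using assms continuous_map_compact_open_eval
    unfolding nscf_def norm_topology_def by (blast intro: continuous_map_compose)
  then have "openin mtopology {f \<in> topspace mtopology. ((\<lambda>f. f x) \<circ> (\<lambda>f. f)) f \<in> ball 0 1}"
    by (rule openin_continuous_map_preimage) simp
  then have "openin mtopology {f \<in> carr F. cmod (f x) < 1}" by simp
  moreover have z: "0 \<in> carr F" using sub by (rule cfun.subspace_0)
  moreover have "0 \<in> {f \<in> carr F. cmod (f x) < 1}" using z by simp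
  ultimately obtain r where r: "r > 0" "mball 0 r \<subseteq> {f \<in> carr F. cmod (f x) < 1}"
    unfolding openin_mtopology by blast
  \<comment> \<open>The multiple of \<open>f\<close> of norm \<open>r/2\<close> lies in the ball.\<close>
  have "cmod (f x) \<le> 2 / r * nrm F f" if f: "f \<in> carr F" for f
  proof (cases "f = 0")
    case True
    moreover have "nrm F 0 = 0" using nf z by (simp add: normed_fun_space_def)
    ultimately show ?thesis by simp
  next
    case False
    then have pos: "nrm F f > 0" using nf f by (force simp: normed_fun_space_def less_le)
    define c where "c = r / (2 * nrm F f)"
    have c: "c > 0" using pos r by (simp add: c_def)
    let ?g = "cscale (- of_real c) f"
    have g: "?g \<in> carr F" using sub f by (rule cfun.subspace_scale)
    have "0 - ?g = cscale (of_real c) f" by (simp add: cscale_def fun_eq_iff)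
    moreover have "nrm F (cscale (of_real c) f) = c * nrm F f"
      using nf f c by (simp add: normed_fun_space_def)
    ultimately have "norm_dist F 0 ?g = r / 2"
      using g z pos by (simp add: norm_dist_def c_def)
    then have "?g \<in> mball 0 r" using g z r by simp
    then have "cmod (?g x) < 1" using r by auto
    then have "c * cmod (f x) < 1" using c by (simp add: cscale_def norm_mult)
    then show ?thesis using pos r by (simp add: c_def field_simps)
  qed
  then show ?thesis by blast
qed

text \<open>The dual norm is a real supremum, which is an upper bound only because boundedness of the
  functional makes the set bounded.\<close>

lemma dual_norm_bound_on_ball:
  assumes nf: "normed_fun_space F"
    and \<phi>: "\<phi> \<in> carr (dual_space F)" and f: "f \<in> closed_unit_ball F"
  shows "cmod (\<phi> f) \<le> nrm (dual_space F) \<phi>"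
proof -
  obtain B where B: "\<And>f. f \<in> carr F \<Longrightarrow> cmod (\<phi> f) \<le> B * nrm F f"
    using \<phi> by (auto simp: dual_space_def)
  have "cmod (\<phi> g) \<le> max B 0" if g: "g \<in> closed_unit_ball F" for g
  proof -
    have "nrm F g \<ge> 0" using nf g by (simp add: normed_fun_space_def closed_unit_ball_def)
    have "cmod (\<phi> g) \<le> B * nrm F g" using B g by (simp add: closed_unit_ball_def)
    also have "\<dots> \<le> max B 0 * 1"
      using \<open>nrm F g \<ge> 0\<close> g by (intro mult_mono) (auto simp: closed_unit_ball_def)
    finally show ?thesis by simp
  qed
  then have "bdd_above ((\<lambda>f. cmod (\<phi> f)) ` closed_unit_ball F)"
    by (rule bdd_aboveI2)
  then show ?thesis using f by (auto simp: dual_space_def intro: cSUP_upper2)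
qed

text \<open>Restricting an element of the bidual to the evaluation functionals \<open>\<delta> x\<close> gives a function on the
  underlying space, and this restriction is pointwise continuous. By reflexivity every function
  obtained in this way belongs to \<open>F\<close>, so the image of the compact bidual ball consists of continuous
  functions, and it contains the unit ball of \<open>F\<close>.\<close>

lemma pointwise_compactly_embedded_if_reflexive:
  assumes F: "nscf F" and refl: "reflexive F"
  shows "pointwise_compactly_embedded F"
proof -
  define \<delta> where "\<delta> x f = (if f \<in> carr F then f x else 0)" for x :: 'a and f
  let ?U = "{\<Psi> \<in> carr (bidual_space F). \<forall>\<phi>\<in>carr (dual_space F). cmod (\<Psi> \<phi>) \<le> nrm (dual_space F) \<phi>}"
  define R where "R \<Psi> x = \<Psi> (\<delta> x)" for \<Psi> :: "(('a \<Rightarrow> complex) \<Rightarrow> complex) \<Rightarrow> complex" and x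
  have nf: "normed_fun_space F" using F by (simp add: nscf_def)
  then have sub: "cfun.subspace (carr F)" by (simp add: normed_fun_space_def)
  have \<delta>: "\<delta> x \<in> carr (dual_space F)" for x
    using nscf_eval_bounded[OF F, of x] cfun.subspace_add[OF sub] cfun.subspace_scale[OF sub]
    by (auto simp: dual_space_def \<delta>_def clinear_on_def cscale_def)
  have R: "R (canonical_embedding F f) = f" if "f \<in> carr F" for f
    using that \<delta> by (simp add: R_def \<delta>_def canonical_embedding_def fun_eq_iff)
  have "continuous_on UNIV R"
    unfolding R_def
    by (intro continuous_on_coordinatewise_then_product continuous_on_product_coordinates)
  then have "compact (R ` ?U)"
    using compact_dual_ball[of "dual_space F"]
    by (rule compact_continuous_image[OF continuous_on_subset[OF _ subset_UNIV]])
  moreover have "open_unit_ball F \<subseteq> R ` ?U"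
  proof
    fix f assume f: "f \<in> open_unit_ball F"
    then have fF: "f \<in> carr F" and fb: "f \<in> closed_unit_ball F"
      by (auto simp: open_unit_ball_def closed_unit_ball_def)
    have "canonical_embedding F f \<in> carr (bidual_space F)"
      using imageI[OF fF, of "canonical_embedding F"] refl by (simp add: reflexive_def)
    then have "canonical_embedding F f \<in> ?U"
      using fb by (simp add: canonical_embedding_def dual_norm_bound_on_ball nf)
    then show "f \<in> R ` ?U" by (rule rev_image_eqI) (simp add: R[OF fF])
  qed
  moreover have "continuous_on UNIV g" if g: "g \<in> R ` ?U" for g
  proof -
    obtain \<Psi> where "\<Psi> \<in> carr (bidual_space F)" "g = R \<Psi>" using g by auto
    then obtain f where "f \<in> carr F" "g = R (canonical_embedding F f)"
      using refl[unfolded reflexive_def, symmetric] by auto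
    then show ?thesis using R nscf_continuous[OF F] by simp
  qed
  ultimately show ?thesis unfolding pointwise_compactly_embedded_def by blast
qed

section \<open>Isometries that act on a set by multiplication\<close>

text \<open>A sequence in a compact set of functions need not have a convergent subsequence, since the product
  topology need not be first countable. It has a cluster point, and wherever the sequence converges
  pointwise the cluster point must take the limit value.\<close>

lemma compact_cluster_point_of_pointwise_limits:
  fixes h :: "nat \<Rightarrow> 'x \<Rightarrow> 'b::t2_space"
  assumes K: "compact K" "\<And>n. h n \<in> K"
    and lim: "\<And>z. z \<in> Z \<Longrightarrow> (\<lambda>n. h n z) \<longlonglongrightarrow> a z"
  obtains g where "g \<in> K" "\<And>z. z \<in> Z \<Longrightarrow> g z = a z"
proof -
  have "eventually (\<lambda>f. f \<in> K) (filtermap h sequentially)"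
    using K(2) by (simp add: eventually_filtermap)
  moreover have "filtermap h sequentially \<noteq> bot" by (simp add: filtermap_bot_iff)
  ultimately obtain g where g: "g \<in> K" "inf (nhds g) (filtermap h sequentially) \<noteq> bot"
    using iffD1[OF compact_filter K(1)] by blast
  have "g z = a z" if z: "z \<in> Z" for z
  proof (rule tendsto_unique[OF g(2)])
    have "continuous_on UNIV (\<lambda>f::'x \<Rightarrow> 'b. f z)" by (rule continuous_on_product_coordinates)
    then have "((\<lambda>f. f z) \<longlongrightarrow> g z) (at g)"
      unfolding continuous_on_def by blast
    then have "((\<lambda>f. f z) \<longlongrightarrow> g z) (nhds g)"
      by (rule iffD1[OF tendsto_at_iff_tendsto_nhds])
    then show "((\<lambda>f. f z) \<longlongrightarrow> g z) (inf (nhds g) (filtermap h sequentially))"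
      by (rule tendsto_mono[OF inf_le1])
    have "((\<lambda>f. f z) \<longlongrightarrow> a z) (filtermap h sequentially)"
      unfolding filterlim_filtermap using lim[OF z] .
    then show "((\<lambda>f. f z) \<longlongrightarrow> a z) (inf (nhds g) (filtermap h sequentially))"
      by (rule tendsto_mono[OF inf_le2])
  qed
  with g(1) show ?thesis by (rule that)
qed

lemma scale_into_open_unit_ball:
  assumes nf: "normed_fun_space F" and f: "f \<in> carr F"
  obtains c where "c \<noteq> 0" "cscale c f \<in> open_unit_ball F"
proof -
  define c where "c = 1 / (2 * (nrm F f + 1))"
  have n: "nrm F f \<ge> 0" using nf f by (simp add: normed_fun_space_def)
  then have c: "c > 0" by (simp add: c_def)
  have "nrm F (cscale (of_real c) f) = c * nrm F f"
    using nf f c by (simp add: normed_fun_space_def)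
  also have "\<dots> < 1" using n by (simp add: c_def field_simps)
  finally have "cscale (of_real c) f \<in> open_unit_ball F"
    using nf f cfun.subspace_scale by (auto simp: open_unit_ball_def normed_fun_space_def)
  then show ?thesis using that[of "of_real c"] c by simp
qed

lemma one_independent_open_unit_ball:
  assumes "normed_fun_space F" "one_independent F"
  obtains f where "f \<in> open_unit_ball F" "f x \<noteq> 0"
proof -
  obtain f where f: "f \<in> carr F" "f x \<noteq> 0" using assms(2) by (auto simp: one_independent_def)
  obtain c where "c \<noteq> 0" "cscale c f \<in> open_unit_ball F"
    using scale_into_open_unit_ball[OF assms(1) f(1)] .
  then show ?thesis using that[of "cscale c f"] f by (simp add: cscale_def)
qed

text \<open>Evaluation at \<open>z\<close> is an eigenvector of the adjoint of the isometry \<open>S\<close> with eigenvalue \<open>m\<close>. Its norm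
  \<open>N\<close> is finite and positive, and because \<open>S\<close> maps the unit ball onto itself, \<open>N = \<bar>m\<bar> N\<close>.\<close>

lemma eigenvalue_unimodular:
  assumes nf: "normed_fun_space F" and ind: "one_independent F"
    and pc: "pointwise_compactly_embedded F" and S: "unitary_map F F S"
    and mult: "\<And>f. f \<in> carr F \<Longrightarrow> S f z = m * f z"
  shows "cmod m = 1"
proof -
  let ?B = "open_unit_ball F"
  define N where "N = (SUP f\<in>?B. cmod (f z))"
  obtain K where K: "compact K" "?B \<subseteq> K"
    using pc by (auto simp: pointwise_compactly_embedded_def)
  have "compact ((\<lambda>f. f z) ` K)"
    by (rule compact_continuous_image[OF continuous_on_subset[OF continuous_on_product_coordinates]])
      (use K in auto)
  then have "bounded ((\<lambda>f. f z) ` K)" by (rule compact_imp_bounded)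
  then obtain C where C: "\<And>f. f \<in> K \<Longrightarrow> cmod (f z) \<le> C"
    by (auto simp: bounded_iff)
  then have bdd: "bdd_above ((\<lambda>f. cmod (f z)) ` ?B)"
    using K(2) C by (intro bdd_aboveI2[of _ _ C]) blast
  obtain f0 where f0: "f0 \<in> ?B" "f0 z \<noteq> 0"
    using one_independent_open_unit_ball[OF nf ind] .
  have upper: "cmod (f z) \<le> N" if "f \<in> ?B" for f
    unfolding N_def using that bdd by (rule cSUP_upper)
  have least: "N \<le> u" if "\<And>f. f \<in> ?B \<Longrightarrow> cmod (f z) \<le> u" for u
    unfolding N_def
  proof (rule cSUP_least)
    show "?B \<noteq> {}" using f0(1) by blast
  qed (rule that)
  have N: "N > 0" using less_le_trans[OF _ upper[OF f0(1)], of 0] f0(2) by simp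
  have "N \<le> cmod m * N"
  proof (rule least)
    fix f assume f: "f \<in> ?B"
    then obtain g where g: "g \<in> carr F" "f = S g"
      using S unfolding unitary_map_def open_unit_ball_def by blast
    then have "g \<in> ?B" using f S by (simp add: open_unit_ball_def unitary_map_def)
    then have "cmod m * cmod (g z) \<le> cmod m * N" by (intro mult_left_mono upper) simp_all
    then show "cmod (f z) \<le> cmod m * N" using g mult by (simp add: norm_mult)
  qed
  then have m: "cmod m \<ge> 1" using N by simp
  then have m_pos: "0 < cmod m" by linarith
  have "N \<le> N / cmod m"
  proof (rule least)
    fix f assume f: "f \<in> ?B"
    then have "S f \<in> ?B" using S by (auto simp: open_unit_ball_def unitary_map_def)
    from upper[OF this] have "cmod m * cmod (f z) \<le> N"
      using f mult by (simp add: norm_mult open_unit_ball_def)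
    then show "cmod (f z) \<le> N / cmod m"
      using m_pos by (simp add: pos_le_divide_eq mult.commute)
  qed
  then have "N * cmod m \<le> N * 1" using m_pos by (simp add: pos_le_divide_eq)
  then have "cmod m \<le> 1" using N by (rule mult_left_le_imp_le)
  with m show ?thesis by simp
qed

text \<open>Strict convexity of the complex plane.\<close>

lemma norm_midpoint_less_1:
  fixes q :: complex
  assumes "cmod q = 1" "q \<noteq> 1"
  shows "cmod ((1 + q) / 2) < 1"
proof (rule ccontr)
  assume "\<not> ?thesis"
  then have "cmod (1 + q) = cmod 1 + cmod q"
    using assms norm_triangle_ineq[of 1 q] by (simp add: norm_divide)
  then have "cmod 1 *\<^sub>R q = cmod q *\<^sub>R 1"
    by (rule iffD1[OF norm_triangle_eq])
  then show False using assms by simp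
qed

text \<open>On \<open>Z\<close>, the iterates of \<open>T = (1 + S/\<mu>)/2\<close> act as a projection onto the \<open>\<mu>\<close>-eigenspace in the
  limit. Since the iterates of \<open>f\<close> remain in the unit ball, compactness turns their pointwise limit on
  \<open>Z\<close> into a continuous function.\<close>

lemma eigenspace_cutoff_continuous:
  fixes m :: "'x::topological_space \<Rightarrow> complex"
  assumes nf: "normed_fun_space F"
    and pc: "pointwise_compactly_embedded F" and S: "unitary_map F F S"
    and mult: "\<And>f z. f \<in> carr F \<Longrightarrow> z \<in> Z \<Longrightarrow> S f z = m z * f z"
    and unimodular: "\<And>z. z \<in> Z \<Longrightarrow> cmod (m z) = 1"
    and f: "f \<in> open_unit_ball F" and \<mu>: "cmod \<mu> = 1"
  shows "\<exists>g. continuous_on UNIV g \<and> (\<forall>z\<in>Z. g z = (if m z = \<mu> then f z else 0))"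
proof -
  obtain K where K: "compact K" "open_unit_ball F \<subseteq> K" "\<And>g. g \<in> K \<Longrightarrow> continuous_on UNIV g"
    using pc by (auto simp: pointwise_compactly_embedded_def)
  define T where "T u = cscale (1/2) (u + cscale (1/\<mu>) (S u))" for u
  define h where "h n = (T ^^ n) f" for n
  have sub: "cfun.subspace (carr F)" using nf by (simp add: normed_fun_space_def)
  have T: "T u \<in> open_unit_ball F" if u: "u \<in> open_unit_ball F" for u
  proof -
    let ?v = "cscale (1/\<mu>) (S u)"
    have uF: "u \<in> carr F" "nrm F u < 1" using u by (auto simp: open_unit_ball_def)
    have SF: "S u \<in> carr F" "nrm F (S u) = nrm F u"
      using S uF by (auto simp: unitary_map_def)
    have v: "?v \<in> carr F" using sub SF by (intro cfun.subspace_scale)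
    have "nrm F ?v = cmod (1/\<mu>) * nrm F (S u)"
      using nf SF unfolding normed_fun_space_def by blast
    then have nv: "nrm F ?v = nrm F u" using \<mu> SF by (simp add: norm_divide)
    have uv: "u + ?v \<in> carr F" using sub uF v by (intro cfun.subspace_add)
    have "nrm F (T u) = cmod (1/2) * nrm F (u + ?v)"
      using nf uv unfolding normed_fun_space_def T_def by blast
    moreover have "nrm F (u + ?v) \<le> nrm F u + nrm F ?v"
      using nf uF v unfolding normed_fun_space_def by blast
    ultimately have "nrm F (T u) < 1" using nv uF by simp
    moreover have "T u \<in> carr F" unfolding T_def using sub uv by (intro cfun.subspace_scale)
    ultimately show ?thesis by (simp add: open_unit_ball_def)
  qed
  have h: "h n \<in> open_unit_ball F" for n
    by (induction n) (use f T in \<open>auto simp: h_def\<close>)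
  have hz: "h n z = ((1 + m z / \<mu>) / 2) ^ n * f z" if z: "z \<in> Z" for n z
  proof (induction n)
    case 0
    show ?case by (simp add: h_def)
  next
    case (Suc n)
    have "h (Suc n) z = (h n z + S (h n) z / \<mu>) / 2"
      by (simp add: h_def T_def cscale_def)
    also have "S (h n) z = m z * h n z"
      using mult h[of n] z by (simp add: open_unit_ball_def)
    also have "(h n z + m z * h n z / \<mu>) / 2 = (1 + m z / \<mu>) / 2 * h n z"
      by (simp add: field_simps)
    finally show ?case using Suc by simp
  qed
  have "(\<lambda>n. h n z) \<longlonglongrightarrow> (if m z = \<mu> then f z else 0)" if z: "z \<in> Z" for z
  proof (cases "m z = \<mu>")
    case True
    moreover have "\<mu> \<noteq> 0" using \<mu> by auto
    ultimately show ?thesis by (simp add: hz[OF z])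
  next
    case False
    have "\<mu> \<noteq> 0" using \<mu> by auto
    with False have "m z / \<mu> \<noteq> 1" by simp
    then have "cmod ((1 + m z / \<mu>) / 2) < 1"
      by (intro norm_midpoint_less_1) (simp_all add: norm_divide unimodular[OF z] \<mu>)
    then have "(\<lambda>n. ((1 + m z / \<mu>) / 2) ^ n * f z) \<longlonglongrightarrow> 0 * f z"
      by (intro tendsto_intros LIMSEQ_power_zero)
    then show ?thesis using False by (simp add: hz[OF z])
  qed
  then obtain g where "g \<in> K" "\<And>z. z \<in> Z \<Longrightarrow> g z = (if m z = \<mu> then f z else 0)"
    using compact_cluster_point_of_pointwise_limits[of K h Z "\<lambda>z. if m z = \<mu> then f z else 0"]
      K(1,2) h by blast
  then show ?thesis using K(3) by blast
qed

text \<open>If \<open>f a \<noteq> 0\<close>, the cut-off of \<open>f\<close> to \<open>{m = m a}\<close> is nonzero at \<open>a\<close>. Being continuous along \<open>Z\<close>, it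
  is nonzero near \<open>a\<close>, which forces \<open>m = m a\<close> there; so \<open>m\<close> is locally constant.\<close>

lemma multiplier_constant:
  fixes m :: "'x::topological_space \<Rightarrow> complex"
  assumes nf: "normed_fun_space F" and ind: "one_independent F"
    and pc: "pointwise_compactly_embedded F" and S: "unitary_map F F S"
    and mult: "\<And>f z. f \<in> carr F \<Longrightarrow> z \<in> Z \<Longrightarrow> S f z = m z * f z"
    and Z: "connected Z" "x \<in> Z" "y \<in> Z"
  shows "m x = m y"
proof (rule connected_local_const[OF Z], rule ballI)
  have unimodular: "cmod (m z) = 1" if "z \<in> Z" for z
    using mult[OF _ that] by (rule eigenvalue_unimodular[OF nf ind pc S])
  fix a assume a: "a \<in> Z"
  obtain f where f: "f \<in> open_unit_ball F" "f a \<noteq> 0"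
    using one_independent_open_unit_ball[OF nf ind] .
  have "\<exists>g. continuous_on UNIV g \<and> (\<forall>z\<in>Z. g z = (if m z = m a then f z else 0))"
    by (rule eigenspace_cutoff_continuous[OF nf pc S mult unimodular f(1) unimodular[OF a]])
  then obtain g where g: "continuous_on UNIV g"
    "\<And>z. z \<in> Z \<Longrightarrow> g z = (if m z = m a then f z else 0)"
    by blast
  have "(g \<longlongrightarrow> g a) (at a within Z)"
    using continuous_on_subset[OF g(1), of Z] a by (simp add: continuous_on_def)
  moreover have "g a \<noteq> 0" using g(2)[OF a] f(2) by simp
  ultimately have "eventually (\<lambda>b. g b \<noteq> 0) (at a within Z)"
    by (rule tendsto_imp_eventually_ne)
  moreover have "eventually (\<lambda>b. b \<in> Z) (at a within Z)"
    unfolding eventually_at_filter by (rule always_eventually) blast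
  ultimately show "eventually (\<lambda>b. m a = m b) (at a within Z)"
  proof eventually_elim
    case (elim b)
    then show ?case using g(2)[of b] by (simp split: if_splits)
  qed
qed

section \<open>Weighted composition operators\<close>

lemma unitary_map_inj_on:
  assumes "normed_fun_space F" "normed_fun_space E" "unitary_map F E T"
  shows "inj_on T (carr F)"
proof (rule inj_onI)
  fix f g assume fg: "f \<in> carr F" "g \<in> carr F" "T f = T g"
  have sub: "cfun.subspace (carr F)" using assms(1) by (simp add: normed_fun_space_def)
  have d: "f - g \<in> carr F" using sub fg by (intro cfun.subspace_diff)
  have "T ((f - g) + g) = T (f - g) + T g"
    using assms(3) d fg unfolding unitary_map_def clinear_on_def by blast
  then have "T (f - g) = 0" using fg by simp
  moreover have "nrm E 0 = 0"
    using assms(2) cfun.subspace_0 by (auto simp: normed_fun_space_def)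
  ultimately have "nrm F (f - g) = 0"
    using assms(3) d unfolding unitary_map_def by metis
  then have "f - g = 0" using assms(1) d unfolding normed_fun_space_def by blast
  then show "f = g" by simp
qed

text \<open>The unitary \<open>S = W\<^sup>-\<^sup>1 V\<close>, where \<open>W\<close> is injective because it is isometric.\<close>

lemma unitary_map_factor:
  assumes F: "normed_fun_space F" and E: "normed_fun_space E"
    and V: "unitary_map F E V" and W: "unitary_map F E W"
  obtains S where "unitary_map F F S" "\<And>f. f \<in> carr F \<Longrightarrow> V f = W (S f)"
proof -
  define S where "S f = inv_into (carr F) W (V f)" for f
  have sub: "cfun.subspace (carr F)" using F by (simp add: normed_fun_space_def)
  have inj: "inj_on W (carr F)" using F E W by (rule unitary_map_inj_on)
  have img: "W ` carr F = V ` carr F" using V W by (simp add: unitary_map_def)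
  have WS: "W (S f) = V f" and SF: "S f \<in> carr F" if "f \<in> carr F" for f
  proof -
    have "V f \<in> W ` carr F" using that img by blast
    then show "W (S f) = V f" "S f \<in> carr F"
      unfolding S_def by (rule f_inv_into_f, rule inv_into_into)
  qed
  have add: "S (f + g) = S f + S g" if "f \<in> carr F" "g \<in> carr F" for f g
  proof (rule inj_onD[OF inj])
    have fg: "f + g \<in> carr F" using sub that by (rule cfun.subspace_add)
    show "S (f + g) \<in> carr F" using fg by (rule SF)
    show "S f + S g \<in> carr F" using sub that SF by (intro cfun.subspace_add)
    have "W (S f + S g) = W (S f) + W (S g)" "V (f + g) = V f + V g"
      using V W that SF unfolding unitary_map_def clinear_on_def by blast+
    then show "W (S (f + g)) = W (S f + S g)" using WS fg that by simp
  qed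
  have scale: "S (cscale c f) = cscale c (S f)" if "f \<in> carr F" for c f
  proof (rule inj_onD[OF inj])
    have cf: "cscale c f \<in> carr F" using sub that by (rule cfun.subspace_scale)
    show "S (cscale c f) \<in> carr F" using cf by (rule SF)
    show "cscale c (S f) \<in> carr F" using sub that SF by (intro cfun.subspace_scale)
    have "W (cscale c (S f)) = cscale c (W (S f))" "V (cscale c f) = cscale c (V f)"
      using V W that SF unfolding unitary_map_def clinear_on_def by blast+
    then show "W (S (cscale c f)) = W (cscale c (S f))" using WS cf that by simp
  qed
  have "carr F \<subseteq> S ` carr F"
  proof
    fix g assume g: "g \<in> carr F"
    then obtain f where f: "f \<in> carr F" "W g = V f" using img by blast
    then have "S f = g" using g inj by (simp add: S_def flip: f(2))
    then show "g \<in> S ` carr F" using f by blast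
  qed
  moreover have "nrm F (S f) = nrm F f" if "f \<in> carr F" for f
    using V W WS SF that unfolding unitary_map_def by metis
  ultimately have "unitary_map F F S"
    using add scale SF by (auto simp: unitary_map_def clinear_on_def)
  then show ?thesis using that WS by simp
qed

text \<open>The multiplier of \<open>S\<close> on \<open>range \<Phi>\<close> is the quotient of the weights, so it has the constant
  unimodular value \<open>\<mu>\<close>, and \<open>1 / \<mu>\<close> is the required factor.\<close>

lemma weighted_comp_factor_constant:
  assumes nf: "normed_fun_space F" and ind: "one_independent F"
    and pc: "pointwise_compactly_embedded F" and S: "unitary_map F F S"
    and conn: "connected (range \<Phi>)"
    and \<omega>: "\<And>y. \<omega> y \<noteq> 0" and \<upsilon>: "\<And>y. \<upsilon> y \<noteq> 0"
    and eq: "\<And>f. f \<in> carr F \<Longrightarrow> weighted_comp \<Phi> \<omega> f = weighted_comp \<Phi> \<upsilon> (S f)"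
  shows "\<exists>c. cmod c = 1 \<and> (\<forall>y. \<upsilon> y = c * \<omega> y)"
proof -
  \<comment> \<open>A point of the range may have several preimages; \<open>1\<close>-independence shows below that the
    quotient of the weights does not depend on the one that \<open>inv \<Phi>\<close> chooses.\<close>
  define m where "m x = \<omega> (inv \<Phi> x) / \<upsilon> (inv \<Phi> x)" for x
  have Seq: "S f (\<Phi> y) = \<omega> y / \<upsilon> y * f (\<Phi> y)" if "f \<in> carr F" for f y
    using fun_cong[OF eq[OF that], of y] \<upsilon>[of y] by (simp add: weighted_comp_def field_simps)
  have mult: "S f z = m z * f z" if "f \<in> carr F" "z \<in> range \<Phi>" for f z
    using Seq[OF that(1), of "inv \<Phi> z"] that(2) by (simp add: m_def f_inv_into_f)
  have m: "m (\<Phi> y) = \<omega> y / \<upsilon> y" for y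
  proof -
    obtain f where f: "f \<in> carr F" "f (\<Phi> y) \<noteq> 0" using ind by (auto simp: one_independent_def)
    have "m (\<Phi> y) * f (\<Phi> y) = \<omega> y / \<upsilon> y * f (\<Phi> y)"
      using Seq[OF f(1), of y] mult[OF f(1), of "\<Phi> y"] by simp
    then show ?thesis using f(2) by (rule iffD1[OF mult_right_cancel, rotated])
  qed
  define \<mu> where "\<mu> = m (\<Phi> undefined)"
  have const: "\<omega> y / \<upsilon> y = \<mu>" for y
    unfolding \<mu>_def m[symmetric]
    by (rule multiplier_constant[OF nf ind pc S mult conn]) auto
  have \<mu>: "cmod \<mu> = 1"
    unfolding \<mu>_def by (rule eigenvalue_unimodular[OF nf ind pc S mult]) auto
  have "\<upsilon> y = 1 / \<mu> * \<omega> y" for y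
    using \<omega>[of y] \<upsilon>[of y] by (simp flip: const[of y])
  then show ?thesis using \<mu> by (intro exI[of _ "1 / \<mu>"]) (simp add: norm_divide)
qed

theorem proposition3p14:
  fixes F :: "'x::t2_space fun_space" and E :: "'y::t2_space fun_space"
    and \<Phi> :: "'y \<Rightarrow> 'x" and \<omega> \<upsilon> :: "'y \<Rightarrow> complex"
  assumes "nscf F" and "one_independent F"
    and "compactly_embedded F \<or>
         (weakly_compactly_embedded F \<and> nearly_strictly_convex F \<and>
           closedin compact_open_topology (closed_unit_ball F)) \<or>
         (weakly_compactly_embedded F \<and> nearly_strictly_convex (bidual_space F)) \<or>
         (reflexive F \<and> nearly_strictly_convex F)"
    and "nscf E"
    and "connected (range \<Phi>)"
    and "\<And>y. \<omega> y \<noteq> 0" and "\<And>y. \<upsilon> y \<noteq> 0"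
  shows "((\<exists>S. unitary_map F F S \<and>
             (\<forall>f\<in>carr F. weighted_comp \<Phi> \<omega> f = weighted_comp \<Phi> \<upsilon> (S f))) \<longrightarrow>
           (\<exists>c. cmod c = 1 \<and> (\<forall>y. \<upsilon> y = c * \<omega> y))) \<and>
         (unitary_map F E (weighted_comp \<Phi> \<omega>) \<and> unitary_map F E (weighted_comp \<Phi> \<upsilon>) \<longrightarrow>
           (\<exists>S. unitary_map F F S \<and>
             (\<forall>f\<in>carr F. weighted_comp \<Phi> \<omega> f = weighted_comp \<Phi> \<upsilon> (S f))))"
proof -
  have F: "normed_fun_space F" and E: "normed_fun_space E"
    using assms by (simp_all add: nscf_def)
  have "pointwise_compactly_embedded F" if "compactly_embedded F"
    using that unfolding compactly_embedded_def
    by (rule pointwise_compactly_embedded_if_relatively_compact)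
      (simp_all add: topspace_compact_open continuous_map_compact_open_eval)
  moreover have "pointwise_compactly_embedded F" if "weakly_compactly_embedded F"
    using that topspace_weak_subset continuous_map_weak_eval unfolding weakly_compactly_embedded_def
    by (rule pointwise_compactly_embedded_if_relatively_compact)
  moreover have "pointwise_compactly_embedded F" if "reflexive F"
    using \<open>nscf F\<close> that by (rule pointwise_compactly_embedded_if_reflexive)
  ultimately have pc: "pointwise_compactly_embedded F" using assms(3) by blast
  show ?thesis
  proof (intro conjI impI)
    assume "\<exists>S. unitary_map F F S \<and>
      (\<forall>f\<in>carr F. weighted_comp \<Phi> \<omega> f = weighted_comp \<Phi> \<upsilon> (S f))"
    then obtain S where S: "unitary_map F F S"
      and eq: "\<And>f. f \<in> carr F \<Longrightarrow> weighted_comp \<Phi> \<omega> f = weighted_comp \<Phi> \<upsilon> (S f)"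
      by auto
    show "\<exists>c. cmod c = 1 \<and> (\<forall>y. \<upsilon> y = c * \<omega> y)"
      using assms(5-7) eq by (rule weighted_comp_factor_constant[OF F assms(2) pc S])
  next
    assume "unitary_map F E (weighted_comp \<Phi> \<omega>) \<and> unitary_map F E (weighted_comp \<Phi> \<upsilon>)"
    then obtain S where "unitary_map F F S"
      "\<And>f. f \<in> carr F \<Longrightarrow> weighted_comp \<Phi> \<omega> f = weighted_comp \<Phi> \<upsilon> (S f)"
      using unitary_map_factor[OF F E] by metis
    then show "\<exists>S. unitary_map F F S \<and>
      (\<forall>f\<in>carr F. weighted_comp \<Phi> \<omega> f = weighted_comp \<Phi> \<upsilon> (S f))"
      by (intro exI[of _ S]) simp
  qed
qed

end
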